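(* Let $r\geq 1$ and $k\geq r-1$ be integers. Then there exists an integer $n_0(k,r)$ such that for every $n\geq n_0(k,r)$, $W(n,k,r)=\binom{n-k+r-1}{r-1}$.
   Context: For a positive integer $n$, $[n]=\{1,2,\ldots,n\}$, and $[n]^{(k)}$ denotes the family of all $k$-element subsets of $[n]$. The trace of a family $\mathcal{A}$ of sets on a set $X$ is $\mathcal{A}|_X=\{A\cap X: A\in\mathcal{A}\}$. For a set $X$ with $|X|=r$, a maximal chain of $X$ is a family $\{X_0,X_1,\ldots,X_r\}$ of subsets of $X$ with $X_0\subset X_1\subset\cdots\subset X_r=X$ and $|X_i|=i$ for all $i$; the trace $\mathcal{A}|_X$ contains a maximal chain of $X$ if every member of such a chain belongs to $\mathcal{A}|_X$. For $n\geq k$ and $r\geq 1$, $W(n,k,r)$ is the maximum size of a family $\mathcal{A}\subseteq[n]^{(k)}$ such that for every $r$-element subset $X$ of $[n]$ the trace $\mathcal{A}|_X$ does not contain a maximal chain of $X$. *)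

theory Defs
  imports "HOL-Library.Ramsey"
begin

definition family_trace :: "'a set set \<Rightarrow> 'a set \<Rightarrow> 'a set set" where
  "family_trace \<A> X = {A \<inter> X | A. A \<in> \<A>}"

definition maximal_chain_of :: "'a set \<Rightarrow> 'a set set \<Rightarrow> bool" where
  "maximal_chain_of X C \<longleftrightarrow> finite X \<and>
     (\<exists>Y :: nat \<Rightarrow> 'a set. C = Y ` {0..card X} \<and>
        (\<forall>i\<le>card X. Y i \<subseteq> X \<and> card (Y i) = i) \<and>
        (\<forall>i<card X. Y i \<subset> Y (Suc i)) \<and>
        Y (card X) = X)"

definition trace_contains_maximal_chain :: "'a set set \<Rightarrow> 'a set \<Rightarrow> bool" where
  "trace_contains_maximal_chain \<A> X \<longleftrightarrow>
     (\<exists>C. maximal_chain_of X C \<and> C \<subseteq> family_trace \<A> X)"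

definition chain_trace_free :: "nat \<Rightarrow> nat \<Rightarrow> nat \<Rightarrow> nat set set \<Rightarrow> bool" where
  "chain_trace_free n k r \<A> \<longleftrightarrow> \<A> \<subseteq> nsets {1..n} k \<and>
     (\<forall>X \<in> nsets {1..n} r. \<not> trace_contains_maximal_chain \<A> X)"

definition W :: "nat \<Rightarrow> nat \<Rightarrow> nat \<Rightarrow> nat" where
  "W n k r = Max {card \<A> | \<A>. chain_trace_free n k r \<A>}"

text \<open>The maximum in the definition of \<open>W\<close> is taken over a finite nonempty set.\<close>

lemma finite_chain_trace_free_cards: "finite {card \<A> | \<A>. chain_trace_free n k r \<A>}"
proof -
  have "finite (nsets {1..n} k)"
    by (simp add: finite_imp_finite_nsets)
  then have "finite {\<A>. chain_trace_free n k r \<A>}"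
    by (auto intro: finite_subset[of _ "Pow (nsets {1..n} k)"] simp: chain_trace_free_def)
  then show ?thesis
    by simp
qed

lemma chain_trace_free_empty: "chain_trace_free n k r {}"
  by (auto simp: chain_trace_free_def trace_contains_maximal_chain_def
      maximal_chain_of_def family_trace_def)

end

theory Submission
  imports Defs
begin

text \<open>Induction on \<open>r\<close> and then on \<open>k\<close>; call a family \<open>r\<close>-free if its trace contains no maximal
chain of any \<open>r\<close>-set. If \<open>F \<subseteq> \<A>\<close> consists of sets containing \<open>x\<close> and a maximal chain of \<open>X\<close> is
traced by \<open>{S - {x} | S \<in> F}\<close>, then any member of \<open>\<A>\<close> disjoint from \<open>X \<union> {x}\<close> supplies the empty
trace and completes a maximal chain of \<open>X \<union> {x}\<close>.

If all members of \<open>\<A>\<close> share a point, delete it and use the hypothesis for \<open>k - 1\<close>. If no \<open>r\<close>-set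
meets all members, all links are \<open>(r - 1)\<close>-free, and double counting gives the bound. Otherwise some
\<open>r\<close>-set \<open>T\<close> meets all members while no point is common. For \<open>x \<in> Q\<close> choose \<open>B \<in> \<A>\<close> avoiding \<open>x\<close>:
the members \<open>S \<supseteq> Q\<close> with \<open>S \<inter> B \<subseteq> Q\<close> form, after removing \<open>x\<close>, an \<open>(r - 1)\<close>-free family, and every
other \<open>S \<supseteq> Q\<close> contains \<open>Q \<union> {b}\<close> for one of at most \<open>k\<close> points \<open>b \<in> B - Q\<close>. Iterating at most \<open>k\<close> times,
only \<open>O(n^(r-2))\<close> members contain a given \<open>x\<close>, hence \<open>|\<A>| = O(n^(r-2))\<close>, which is too small
for large \<open>n\<close>.\<close>

section \<open>Chains in traces\<close>

text \<open>No ground set is fixed here, so that inductions may pass freely from \<open>V\<close> to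
  \<open>V - {x}\<close>.\<close>

definition chain_free :: "nat \<Rightarrow> 'a set set \<Rightarrow> bool" where
  "chain_free r \<A> \<longleftrightarrow> (\<forall>X. card X = r \<longrightarrow> \<not> trace_contains_maximal_chain \<A> X)"

text \<open>Members of a trace on \<open>X\<close> are subsets of \<open>X\<close>, and a subset of
  full size is \<open>X\<close>; two clauses of the definition thus come for free.\<close>

lemma trace_contains_maximal_chain_iff:
  "trace_contains_maximal_chain \<A> X \<longleftrightarrow> finite X \<and>
     (\<exists>Y. (\<forall>i\<le>card X. Y i \<in> family_trace \<A> X \<and> card (Y i) = i) \<and> (\<forall>i<card X. Y i \<subset> Y (Suc i)))"
  (is "?L \<longleftrightarrow> ?R")
proof
  assume ?L
  then obtain C Y where "finite X" "C \<subseteq> family_trace \<A> X" "C = Y ` {0..card X}"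
    "\<forall>i\<le>card X. Y i \<subseteq> X \<and> card (Y i) = i" "\<forall>i<card X. Y i \<subset> Y (Suc i)"
    unfolding trace_contains_maximal_chain_def maximal_chain_of_def by blast
  then show ?R
    by (intro conjI exI[of _ Y]) auto
next
  assume ?R
  then obtain Y where fin: "finite X"
    and Y: "\<And>i. i \<le> card X \<Longrightarrow> Y i \<in> family_trace \<A> X" "\<And>i. i \<le> card X \<Longrightarrow> card (Y i) = i"
      "\<And>i. i < card X \<Longrightarrow> Y i \<subset> Y (Suc i)"
    by blast
  have sub: "Y i \<subseteq> X" if "i \<le> card X" for i
    using Y(1)[OF that] by (auto simp: family_trace_def)
  have "Y (card X) = X"
    using sub[of "card X"] Y(2)[of "card X"] fin by (simp add: card_subset_eq)
  then have "maximal_chain_of X (Y ` {0..card X})"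
    unfolding maximal_chain_of_def using fin sub Y(2,3) by (intro conjI exI[of _ Y]) auto
  moreover have "Y ` {0..card X} \<subseteq> family_trace \<A> X"
    using Y(1) by auto
  ultimately show ?L
    unfolding trace_contains_maximal_chain_def by blast
qed

lemma trace_contains_maximal_chain_mono:
  assumes "trace_contains_maximal_chain \<A> X" "family_trace \<A> X \<subseteq> family_trace \<B> X"
  shows "trace_contains_maximal_chain \<B> X"
  using assms unfolding trace_contains_maximal_chain_def by blast

lemma trace_contains_maximal_chain_top:
  assumes "trace_contains_maximal_chain \<A> X"
  obtains A where "A \<in> \<A>" "X \<subseteq> A"
proof -
  have "X \<in> family_trace \<A> X"
    using assms unfolding trace_contains_maximal_chain_def maximal_chain_of_def by fastforce
  then show ?thesis
    using that by (auto simp: family_trace_def)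
qed

lemma trace_contains_maximal_chain_bot:
  fixes \<A> :: "'a set set"
  assumes "trace_contains_maximal_chain \<A> X"
  obtains A where "A \<in> \<A>" "X \<inter> A = {}"
proof -
  obtain Y :: "nat \<Rightarrow> 'a set" where fin: "finite X" and Y: "Y 0 \<in> family_trace \<A> X" "card (Y 0) = 0"
    using assms unfolding trace_contains_maximal_chain_iff by blast
  then obtain A where A: "A \<in> \<A>" "Y 0 = A \<inter> X"
    by (auto simp: family_trace_def)
  then have "A \<inter> X = {}"
    using Y(2) fin by simp
  then show ?thesis
    using A(1) that by blast
qed

section \<open>Deleting a point and passing to links\<close>

text \<open>The top of a chain lies in a member without \<open>x\<close>, so \<open>X\<close> misses
  \<open>x\<close> and the deletion does not change traces on \<open>X\<close>.\<close>

lemma chain_free_remove_point: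
  assumes "chain_free r \<A>" "\<F> \<subseteq> \<A>"
  shows "chain_free r ((\<lambda>S. S - {x}) ` \<F>)"
  unfolding chain_free_def
proof (intro allI impI notI)
  fix X :: "'a set"
  assume X: "card X = r" and tr: "trace_contains_maximal_chain ((\<lambda>S. S - {x}) ` \<F>) X"
  have "x \<notin> X"
    using trace_contains_maximal_chain_top[OF tr] by blast
  then have "family_trace ((\<lambda>S. S - {x}) ` \<F>) X \<subseteq> family_trace \<A> X"
    using assms(2) unfolding family_trace_def by blast
  then have "trace_contains_maximal_chain \<A> X"
    using tr trace_contains_maximal_chain_mono by blast
  then show False
    using assms(1) X unfolding chain_free_def by blast
qed

lemma trace_contains_maximal_chain_insert:
  assumes tr: "trace_contains_maximal_chain ((\<lambda>S. S - {x}) ` \<F>) X"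
    and F: "\<F> \<subseteq> \<A>" "\<And>S. S \<in> \<F> \<Longrightarrow> x \<in> S"
    and B: "B \<in> \<A>" "B \<inter> insert x X = {}"
  shows "trace_contains_maximal_chain \<A> (insert x X)"
proof -
  let ?G = "(\<lambda>S. S - {x}) ` \<F>"
  have x: "x \<notin> X"
    using trace_contains_maximal_chain_top[OF tr] by blast
  obtain Y where fin: "finite X"
    and Y: "\<And>i. i \<le> card X \<Longrightarrow> Y i \<in> family_trace ?G X" "\<And>i. i \<le> card X \<Longrightarrow> card (Y i) = i"
      "\<And>i. i < card X \<Longrightarrow> Y i \<subset> Y (Suc i)"
    using tr unfolding trace_contains_maximal_chain_iff by blast
  have sub: "Y i \<subseteq> X" if "i \<le> card X" for i
    using Y(1)[OF that] by (auto simp: family_trace_def)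
  \<comment> \<open>The old chain shifted up by one place, with \<open>x\<close> added to each set;
    \<open>B\<close> realises the new empty bottom.\<close>
  define Z where "Z i = (case i of 0 \<Rightarrow> {} | Suc j \<Rightarrow> insert x (Y j))" for i
  have card: "card (insert x X) = Suc (card X)"
    using x fin by simp
  have "Z i \<in> family_trace \<A> (insert x X) \<and> card (Z i) = i" if "i \<le> Suc (card X)" for i
  proof (cases i)
    case 0
    then show ?thesis
      using B by (auto simp: Z_def family_trace_def)
  next
    case (Suc j)
    then have j: "j \<le> card X"
      using that by simp
    obtain S where S: "S \<in> \<F>" "Y j = (S - {x}) \<inter> X"
      using Y(1)[OF j] by (auto simp: family_trace_def)
    have "insert x (Y j) = S \<inter> insert x X"
      using S F(2) x by auto
    moreover have "card (insert x (Y j)) = i"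
      using sub[OF j] x fin Y(2)[OF j] Suc by (metis card_insert_disjoint finite_subset in_mono)
    ultimately show ?thesis
      using Suc S F(1) by (auto simp: Z_def family_trace_def)
  qed
  moreover have "Z i \<subset> Z (Suc i)" if "i < Suc (card X)" for i
  proof (cases i)
    case (Suc j)
    then have "Y j \<subset> Y (Suc j)" "x \<notin> Y (Suc j)"
      using that Y(3)[of j] sub[of "Suc j"] x by auto
    then show ?thesis
      using Suc by (auto simp: Z_def)
  qed (auto simp: Z_def)
  ultimately show ?thesis
    unfolding trace_contains_maximal_chain_iff card using fin by (intro conjI exI[of _ Z]) auto
qed

text \<open>Hypothesis \<open>B\<close> concerns only sets \<open>X\<close> that carry a chain, so
  its top and bottom may help to find the disjoint member.\<close>

lemma chain_free_link:
  assumes "chain_free (Suc r) \<A>"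
    and F: "\<F> \<subseteq> \<A>" "\<And>S. S \<in> \<F> \<Longrightarrow> x \<in> S"
    and B: "\<And>X. card X = r \<Longrightarrow> trace_contains_maximal_chain ((\<lambda>S. S - {x}) ` \<F>) X
              \<Longrightarrow> \<exists>B\<in>\<A>. B \<inter> insert x X = {}"
  shows "chain_free r ((\<lambda>S. S - {x}) ` \<F>)"
  unfolding chain_free_def
proof (intro allI impI notI)
  fix X :: "'a set"
  assume X: "card X = r" and tr: "trace_contains_maximal_chain ((\<lambda>S. S - {x}) ` \<F>) X"
  have "trace_contains_maximal_chain \<A> (insert x X)"
    using B[OF X tr] trace_contains_maximal_chain_insert[OF tr F] by blast
  moreover have "x \<notin> X"
    using trace_contains_maximal_chain_top[OF tr] by blast
  moreover have "finite X"
    using tr by (simp add: trace_contains_maximal_chain_iff)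
  ultimately show False
    using assms(1) X unfolding chain_free_def by (metis card_insert_disjoint)
qed

lemma card_image_remove_common:
  assumes "\<And>S. S \<in> \<F> \<Longrightarrow> x \<in> S"
  shows "card ((\<lambda>S. S - {x}) ` \<F>) = card \<F>"
  by (intro card_image inj_onI) (metis assms insert_Diff)

lemma nsets_image_remove_common:
  assumes "\<F> \<subseteq> nsets V (Suc k)" "\<And>S. S \<in> \<F> \<Longrightarrow> x \<in> S"
  shows "(\<lambda>S. S - {x}) ` \<F> \<subseteq> nsets (V - {x}) k"
  using assms by (auto simp: nsets_def)

section \<open>Degrees in families without a common point\<close>

text \<open>The induction is on \<open>j\<close>: after \<open>j\<close> further points,
  \<open>Q\<close> is too large to fit into a member. Each round costs a factor
  \<open>k + 2\<close>, one for \<open>\<F>\<close> and at most \<open>Suc k\<close> for the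
  branches over \<open>B - Q\<close>.\<close>

lemma card_containing_le:
  fixes \<A> :: "'a set set"
  assumes "finite V" "\<A> \<subseteq> nsets V (Suc k)" "chain_free (Suc r) \<A>"
    and nocommon: "\<And>x. \<exists>B\<in>\<A>. x \<notin> B"
    and M: "\<And>x \<F>. x \<in> V \<Longrightarrow> \<F> \<subseteq> nsets (V - {x}) k \<Longrightarrow> chain_free r \<F> \<Longrightarrow> card \<F> \<le> M"
    and "x \<in> Q" "Q \<subseteq> V" "Suc k < card Q + j"
  shows "card {S \<in> \<A>. Q \<subseteq> S} \<le> (k + 2) ^ j * M"
  using \<open>x \<in> Q\<close> \<open>Q \<subseteq> V\<close> \<open>Suc k < card Q + j\<close>
proof (induction j arbitrary: Q)
  case 0
  have "\<not> Q \<subseteq> S" if "S \<in> \<A>" for S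
    using 0 that assms(2) by (auto simp: nsets_def dest!: card_mono)
  then have "{S \<in> \<A>. Q \<subseteq> S} = {}"
    by blast
  then show ?case
    by (simp only: card.empty le0)
next
  case (Suc j)
  have finA: "finite \<A>"
    using assms(1,2) finite_imp_finite_nsets finite_subset by metis
  obtain B where B: "B \<in> \<A>" "x \<notin> B"
    using nocommon by blast
  have finB: "finite B" and cardB: "card B = Suc k" and BV: "B \<subseteq> V"
    using B assms(2) by (auto simp: nsets_def)
  define \<F> where "\<F> = {S \<in> \<A>. Q \<subseteq> S \<and> S \<inter> B \<subseteq> Q}"
  have x: "S \<in> \<F> \<Longrightarrow> x \<in> S" for S
    using Suc.prems by (auto simp: \<F>_def)
  have "chain_free r ((\<lambda>S. S - {x}) ` \<F>)"
  proof (rule chain_free_link[OF assms(3) _ x])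
    show "\<F> \<subseteq> \<A>"
      by (auto simp: \<F>_def)
    fix X assume tr: "trace_contains_maximal_chain ((\<lambda>S. S - {x}) ` \<F>) X"
    obtain S where S: "S \<in> \<F>" "X \<subseteq> S - {x}"
      using trace_contains_maximal_chain_top[OF tr] by blast
    obtain S' where S': "S' \<in> \<F>" "X \<inter> (S' - {x}) = {}"
      using trace_contains_maximal_chain_bot[OF tr] by blast
    \<comment> \<open>\<open>S'\<close> contains \<open>Q\<close> and meets \<open>X\<close> at most
      in \<open>x\<close>, which is not in \<open>X\<close>. Then \<open>X \<inter> B\<close> lies
      in \<open>S \<inter> B\<close>, hence in \<open>Q\<close>, and so is empty.\<close>
    have "X \<inter> Q = {}"
      using S S' by (auto simp: \<F>_def)
    then have "B \<inter> insert x X = {}"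
      using S B by (auto simp: \<F>_def)
    then show "\<exists>B\<in>\<A>. B \<inter> insert x X = {}"
      using B by blast
  qed
  moreover have "(\<lambda>S. S - {x}) ` \<F> \<subseteq> nsets (V - {x}) k"
    by (rule nsets_image_remove_common) (use x assms(2) in \<open>auto simp: \<F>_def\<close>)
  ultimately have F: "card \<F> \<le> M"
    using M[of x] Suc.prems card_image_remove_common[of \<F> x] x by (metis in_mono)
  have branch: "card {S \<in> \<A>. insert b Q \<subseteq> S} \<le> (k + 2) ^ j * M" if "b \<in> B - Q" for b
  proof (rule Suc.IH)
    have "finite Q"
      using Suc.prems assms(1) finite_subset by blast
    then show "Suc k < card (insert b Q) + j"
      using that Suc.prems by simp
  qed (use Suc.prems BV that in auto)
  have "{S \<in> \<A>. Q \<subseteq> S} \<subseteq> \<F> \<union> (\<Union>b\<in>B - Q. {S \<in> \<A>. insert b Q \<subseteq> S})"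
    by (auto simp: \<F>_def)
  then have "card {S \<in> \<A>. Q \<subseteq> S} \<le> card (\<F> \<union> (\<Union>b\<in>B - Q. {S \<in> \<A>. insert b Q \<subseteq> S}))"
    by (rule card_mono[rotated]) (use finA finB in \<open>auto simp: \<F>_def\<close>)
  also have "\<dots> \<le> card \<F> + card (\<Union>b\<in>B - Q. {S \<in> \<A>. insert b Q \<subseteq> S})"
    by (rule card_Un_le)
  also have "card (\<Union>b\<in>B - Q. {S \<in> \<A>. insert b Q \<subseteq> S})
      \<le> (\<Sum>b\<in>B - Q. card {S \<in> \<A>. insert b Q \<subseteq> S})"
    using finB by (intro card_UN_le) auto
  also have "\<dots> \<le> card (B - Q) * ((k + 2) ^ j * M)"
    using sum_bounded_above[of "B - Q" _ "(k + 2) ^ j * M"] branch by simp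
  also have "card (B - Q) \<le> Suc k"
    using cardB finB by (metis Diff_subset card_mono)
  also have "card \<F> + Suc k * ((k + 2) ^ j * M) \<le> (k + 2) ^ j * M + Suc k * ((k + 2) ^ j * M)"
  proof -
    have "1 * M \<le> (k + 2) ^ j * M"
      by (intro mult_le_mono1 one_le_power) simp
    then show ?thesis
      using F by linarith
  qed
  also have "\<dots> = (k + 2) ^ Suc j * M"
    by (simp add: algebra_simps)
  finally show ?case
    by simp
qed

lemma card_times_uniform_eq_sum_degrees:
  assumes "finite V" "\<A> \<subseteq> nsets V k"
  shows "k * card \<A> = (\<Sum>x\<in>V. card {S \<in> \<A>. x \<in> S})"
proof -
  have finA: "finite \<A>"
    using assms finite_imp_finite_nsets finite_subset by metis
  have "card {x \<in> V. x \<in> S} = k" if "S \<in> \<A>" for S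
  proof -
    have "{x \<in> V. x \<in> S} = S" "card S = k"
      using that assms by (auto simp: nsets_def)
    then show ?thesis
      by simp
  qed
  then show ?thesis
    using sum_multicount[OF assms(1) finA, of "(\<in>)" k] by simp
qed

section \<open>The upper bound\<close>

text \<open>The target is a multiple of the link bound that grows linearly in \<open>card V\<close>.
  The lower bound on \<open>card V\<close> lets this multiple exceed the constant obtained from a
  small transversal.\<close>

lemma card_chain_free_le_step:
  fixes \<A> :: "'a set set"
  assumes V: "finite V" "Suc k + Suc s * (Suc (Suc s) * (k + 2) ^ (k + 2)) \<le> card V"
    and A: "\<A> \<subseteq> nsets V (Suc k)" "chain_free (Suc (Suc s)) \<A>" and "s \<le> k"
    and M: "\<And>x \<F>. x \<in> V \<Longrightarrow> \<F> \<subseteq> nsets (V - {x}) k \<Longrightarrow> chain_free (Suc s) \<F>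
              \<Longrightarrow> card \<F> \<le> (card V - Suc k + s) choose s"
    and nocommon: "\<And>x. \<exists>B\<in>\<A>. x \<notin> B"
  shows "card \<A> \<le> (card V - Suc k + Suc s) choose (Suc s)"
proof -
  define M' where "M' = (card V - Suc k + s) choose s"
  define G where "G = (card V - Suc k + Suc s) choose (Suc s)"
  have G: "Suc s * G = (card V - Suc k + Suc s) * M'"
    unfolding G_def M'_def using Suc_times_binomial_eq[of "card V - Suc k + s" s] by (simp add: mult.commute)
  have finA: "finite \<A>"
    using V A finite_imp_finite_nsets finite_subset by metis
  show ?thesis
  proof (cases "\<exists>T. finite T \<and> T \<subseteq> V \<and> card T \<le> Suc (Suc s) \<and> (\<forall>B\<in>\<A>. B \<inter> T \<noteq> {})")
    case True
    then obtain T where T: "finite T" "T \<subseteq> V" "card T \<le> Suc (Suc s)" "\<And>B. B \<in> \<A> \<Longrightarrow> B \<inter> T \<noteq> {}"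
      by blast
    \<comment> \<open>With \<open>Q = {t}\<close>, depth \<open>k + 2\<close> suffices because
      \<open>Suc k < 1 + (k + 2)\<close>.\<close>
    have deg: "card {S \<in> \<A>. {t} \<subseteq> S} \<le> (k + 2) ^ (k + 2) * M'" if "t \<in> T" for t
      by (rule card_containing_le[OF V(1) A nocommon, where x = t])
        (use that T M in \<open>auto simp: M'_def\<close>)
    have "\<A> \<subseteq> (\<Union>t\<in>T. {S \<in> \<A>. {t} \<subseteq> S})"
      using T(4) by blast
    then have "card \<A> \<le> card (\<Union>t\<in>T. {S \<in> \<A>. {t} \<subseteq> S})"
      by (rule card_mono[rotated]) (use T finA in auto)
    also have "\<dots> \<le> (\<Sum>t\<in>T. card {S \<in> \<A>. {t} \<subseteq> S})"
      using T by (intro card_UN_le) auto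
    also have "\<dots> \<le> card T * ((k + 2) ^ (k + 2) * M')"
      using sum_bounded_above[of T _ "(k + 2) ^ (k + 2) * M'"] deg by simp
    also have "\<dots> \<le> Suc (Suc s) * ((k + 2) ^ (k + 2) * M')"
      using T(3) by (intro mult_le_mono1)
    finally have "Suc s * card \<A> \<le> Suc s * (Suc (Suc s) * ((k + 2) ^ (k + 2) * M'))"
      by (rule mult_le_mono2)
    also have "\<dots> = (Suc s * (Suc (Suc s) * (k + 2) ^ (k + 2))) * M'"
      by (simp only: mult.assoc)
    also have "\<dots> \<le> (card V - Suc k + Suc s) * M'"
      using V(2) by (intro mult_le_mono1) linarith
    finally have "Suc s * card \<A> \<le> Suc s * G"
      by (simp only: G)
    then show ?thesis
      unfolding G_def by (simp only: Suc_mult_le_cancel1)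
  next
    case False
    have deg: "card {S \<in> \<A>. x \<in> S} \<le> M'" if x: "x \<in> V" for x
    proof -
      let ?F = "{S \<in> \<A>. x \<in> S}"
      have "chain_free (Suc s) ((\<lambda>S. S - {x}) ` ?F)"
      proof (rule chain_free_link[OF A(2)])
        fix X assume X: "card X = Suc s" "trace_contains_maximal_chain ((\<lambda>S. S - {x}) ` ?F) X"
        obtain S where "S \<in> (\<lambda>S. S - {x}) ` ?F" "X \<subseteq> S"
          using trace_contains_maximal_chain_top[OF X(2)] .
        then have "X \<subseteq> V"
          using A(1) by (auto simp: nsets_def)
        moreover have "finite X"
          using X(1) by (intro card_ge_0_finite) simp
        ultimately have "finite (insert x X)" "insert x X \<subseteq> V" "card (insert x X) \<le> Suc (Suc s)"
          using x X(1) card_insert_le_m1[of "Suc (Suc s)" X x] by auto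
        \<comment> \<open>\<open>insert x X\<close> is too small to be a transversal, so some member
          misses it.\<close>
        then show "\<exists>B\<in>\<A>. B \<inter> insert x X = {}"
          using False by blast
      qed auto
      moreover have "(\<lambda>S. S - {x}) ` ?F \<subseteq> nsets (V - {x}) k"
        by (rule nsets_image_remove_common) (use A in auto)
      ultimately have "card ((\<lambda>S. S - {x}) ` ?F) \<le> M'"
        using M x unfolding M'_def by blast
      then show ?thesis
        using card_image_remove_common[of ?F x] by simp
    qed
    have "Suc k * card \<A> = (\<Sum>x\<in>V. card {S \<in> \<A>. x \<in> S})"
      using V(1) A(1) by (rule card_times_uniform_eq_sum_degrees)
    also have "\<dots> \<le> of_nat (card V) * M'"
      using deg by (rule sum_bounded_above)
    finally have "Suc k * card \<A> \<le> card V * M'"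
      by (simp only: of_nat_id)
    then have "Suc s * (Suc k * card \<A>) \<le> (Suc s * card V) * M'"
      unfolding mult.assoc by (rule mult_le_mono2)
    \<comment> \<open>Writing \<open>card V = a + Suc k\<close>, both sides share
      \<open>Suc s * Suc k\<close>, and what remains is
      \<open>Suc s * a \<le> Suc k * a\<close>.\<close>
    also have "Suc s * card V \<le> Suc k * (card V - Suc k + Suc s)"
    proof -
      define a where "a = card V - Suc k"
      have "card V = a + Suc k"
        using V(2) unfolding a_def by linarith
      then have "Suc s * card V = Suc s * a + Suc s * Suc k"
        by (simp only: distrib_left)
      also have "\<dots> \<le> Suc k * a + Suc s * Suc k"
        using \<open>s \<le> k\<close> by (intro add_le_mono1 mult_le_mono1) simp
      also have "\<dots> = Suc k * (a + Suc s)"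
        by (simp only: distrib_left mult.commute)
      finally show ?thesis
        unfolding a_def .
    qed
    also have "Suc k * (card V - Suc k + Suc s) * M' = Suc k * (Suc s * G)"
      by (simp only: G mult.assoc)
    also have "\<dots> = Suc s * (Suc k * G)"
      by (rule mult.left_commute)
    finally have "Suc s * (Suc k * card \<A>) \<le> Suc s * (Suc k * G)"
      by (simp only: mult_le_mono1)
    then show ?thesis
      unfolding G_def by (simp only: Suc_mult_le_cancel1)
  qed
qed

text \<open>Two distinct sets of equal size are separated by a point \<open>x\<close>, and their
  traces form a maximal chain of \<open>{x}\<close>.\<close>

lemma chain_free_1_card_le:
  assumes "finite V" "\<A> \<subseteq> nsets V k" "chain_free (Suc 0) \<A>"
  shows "card \<A> \<le> 1"
proof -
  have "A = B" if AB: "A \<in> \<A>" "B \<in> \<A>" for A B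
  proof (rule ccontr)
    assume "A \<noteq> B"
    moreover have "finite B" "card A = card B"
      using AB assms(2) by (auto simp: nsets_def)
    ultimately obtain x where x: "x \<in> A" "x \<notin> B"
      using card_subset_eq by blast
    define Y where "Y i = (if i = 0 then {} else {x})" for i :: nat
    have "{} \<in> family_trace \<A> {x}" "{x} \<in> family_trace \<A> {x}"
      using x AB by (auto simp: family_trace_def)
    then have "trace_contains_maximal_chain \<A> {x}"
      unfolding trace_contains_maximal_chain_iff
      by (intro conjI exI[of _ Y]) (auto simp: Y_def le_Suc_eq)
    then show False
      using assms(3) unfolding chain_free_def by force
  qed
  moreover have "finite \<A>"
    using assms finite_imp_finite_nsets finite_subset by metis
  ultimately show ?thesis
    by (auto simp: card_le_Suc0_iff_eq)
qed

lemma card_chain_free_le: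
  assumes "s \<le> k"
  shows "\<exists>n0. \<forall>V (\<A> :: 'a set set). finite V \<longrightarrow> n0 \<le> card V \<longrightarrow> \<A> \<subseteq> nsets V k \<longrightarrow>
           chain_free (Suc s) \<A> \<longrightarrow> card \<A> \<le> (card V - k + s) choose s"
  using assms
proof (induction s arbitrary: k)
  case 0
  then show ?case
    using chain_free_1_card_le by (metis binomial_n_0)
next
  case (Suc s)
  note IHs = Suc.IH
  show ?case
    using \<open>Suc s \<le> k\<close>
  proof (induction k rule: dec_induct)
    case base
    \<comment> \<open>When the sets have size \<open>Suc s\<close>, the bound just counts all of
      them.\<close>
    have "card \<A> \<le> (card V - Suc s + Suc s) choose Suc s"
      if "finite V" "Suc s \<le> card V" "\<A> \<subseteq> nsets V (Suc s)" for V and \<A> :: "'a set set"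
      using that card_mono[OF finite_imp_finite_nsets that(3)] by simp
    then show ?case
      by blast
  next
    case (step k)
    obtain n1 where n1: "\<And>V (\<A> :: 'a set set). finite V \<Longrightarrow> n1 \<le> card V \<Longrightarrow> \<A> \<subseteq> nsets V k \<Longrightarrow>
        chain_free (Suc s) \<A> \<Longrightarrow> card \<A> \<le> (card V - k + s) choose s"
      using IHs[of k] step.hyps by (metis Suc_leD)
    obtain n2 where n2: "\<And>V (\<A> :: 'a set set). finite V \<Longrightarrow> n2 \<le> card V \<Longrightarrow> \<A> \<subseteq> nsets V k \<Longrightarrow>
        chain_free (Suc (Suc s)) \<A> \<Longrightarrow> card \<A> \<le> (card V - k + Suc s) choose Suc s"
      using step.IH by metis
    \<comment> \<open>\<open>n1\<close> and \<open>n2\<close> are raised by one because they are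
      applied to \<open>V - {x}\<close>; the last summand is what the step lemma demands.\<close>
    define n0 where "n0 = Suc n1 + Suc n2 + (Suc k + Suc s * (Suc (Suc s) * (k + 2) ^ (k + 2)))"
    have "card \<A> \<le> (card V - Suc k + Suc s) choose Suc s"
      if V: "finite V" "n0 \<le> card V" and A: "\<A> \<subseteq> nsets V (Suc k)" "chain_free (Suc (Suc s)) \<A>"
      for V and \<A> :: "'a set set"
    proof (cases "\<exists>x. \<forall>B\<in>\<A>. x \<in> B")
      case True
      then obtain x where x: "\<And>B. B \<in> \<A> \<Longrightarrow> x \<in> B"
        by blast
      show ?thesis
      proof (cases "\<A> = {}")
        case False
        then have "x \<in> V"
          using x A by (fastforce simp: nsets_def)
        then have "card (V - {x}) = card V - 1"
          using V by simp
        \<comment> \<open>Set size and ground set both drop by one, so their difference, and with it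
          the bound, is unchanged.\<close>
        moreover have "card ((\<lambda>S. S - {x}) ` \<A>) \<le> (card (V - {x}) - k + Suc s) choose Suc s"
        proof (rule n2)
          have "n2 \<le> card V - 1"
            using V(2) unfolding n0_def by linarith
          then show "n2 \<le> card (V - {x})"
            using V(1) \<open>x \<in> V\<close> by simp
          show "(\<lambda>S. S - {x}) ` \<A> \<subseteq> nsets (V - {x}) k"
            using A(1) x by (rule nsets_image_remove_common)
          show "chain_free (Suc (Suc s)) ((\<lambda>S. S - {x}) ` \<A>)"
            using A(2) by (rule chain_free_remove_point) simp
        qed (use V in simp)
        ultimately show ?thesis
          using card_image_remove_common[of \<A> x] x by simp
      qed simp
    next
      case False
      show ?thesis
      proof (rule card_chain_free_le_step[OF V(1) _ A])
        show "Suc k + Suc s * (Suc (Suc s) * (k + 2) ^ (k + 2)) \<le> card V"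
          using V(2) unfolding n0_def by linarith
        show "s \<le> k"
          using step.hyps by simp
        show "\<exists>B\<in>\<A>. x \<notin> B" for x
          using False by blast
        fix x and \<F> :: "'a set set"
        assume x: "x \<in> V" and F: "\<F> \<subseteq> nsets (V - {x}) k" "chain_free (Suc s) \<F>"
        have "card (V - {x}) = card V - 1"
          using V x by simp
        moreover have "n1 \<le> card V - 1"
          using V(2) unfolding n0_def by linarith
        ultimately show "card \<F> \<le> (card V - Suc k + s) choose s"
          using n1[of "V - {x}" \<F>] V F by simp
      qed
    qed
    then show ?case
      by blast
  qed
qed

section \<open>The extremal family and the conclusion\<close>

text \<open>The member tracing the empty set contains \<open>K\<close>, so \<open>X\<close> avoids
  \<open>K\<close>; the member tracing \<open>X\<close> then has too few points outside
  \<open>K\<close>.\<close>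

lemma chain_free_common_subset:
  assumes "\<And>S. S \<in> \<A> \<Longrightarrow> K \<subseteq> S \<and> finite S \<and> card (S - K) < r"
  shows "chain_free r \<A>"
  unfolding chain_free_def
proof (intro allI impI notI)
  fix X :: "'a set"
  assume X: "card X = r" and tr: "trace_contains_maximal_chain \<A> X"
  obtain S where S: "S \<in> \<A>" "X \<subseteq> S"
    using trace_contains_maximal_chain_top[OF tr] .
  obtain S' where S': "S' \<in> \<A>" "X \<inter> S' = {}"
    using trace_contains_maximal_chain_bot[OF tr] .
  have "X \<subseteq> S - K"
    using S S' assms by blast
  then have "card X \<le> card (S - K)"
    using assms[OF S(1)] by (intro card_mono) auto
  then show False
    using X assms[OF S(1)] by simp
qed

text \<open>The witness consists of all sets that add \<open>s\<close> points to the fixed core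
  \<open>K\<close>.\<close>

lemma exists_chain_free_family:
  assumes "finite V" "K \<subseteq> V"
  shows "\<exists>\<A>. \<A> \<subseteq> nsets V (card K + s) \<and> chain_free (Suc s) \<A> \<and>
           card \<A> = (card V - card K) choose s"
proof (intro exI conjI)
  let ?A = "(\<lambda>Z. K \<union> Z) ` nsets (V - K) s"
  have finK: "finite K"
    using assms finite_subset by blast
  have Z: "finite Z" "Z \<inter> K = {}" "card Z = s" "Z \<subseteq> V" if "Z \<in> nsets (V - K) s" for Z
    using that by (auto simp: nsets_def)
  show "?A \<subseteq> nsets V (card K + s)"
  proof
    fix S assume "S \<in> ?A"
    then obtain Z where S: "S = K \<union> Z" "Z \<in> nsets (V - K) s"
      by blast
    have "card (K \<union> Z) = card K + s"
      using Z[OF S(2)] finK by (simp add: card_Un_disjoint Int_commute)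
    then show "S \<in> nsets V (card K + s)"
      using S Z[OF S(2)] finK assms by (auto simp: nsets_def)
  qed
  show "chain_free (Suc s) ?A"
  proof (rule chain_free_common_subset)
    fix S assume "S \<in> ?A"
    then obtain Z where S: "S = K \<union> Z" "Z \<in> nsets (V - K) s"
      by blast
    have "S - K = Z"
      using S Z[OF S(2)] by blast
    then show "K \<subseteq> S \<and> finite S \<and> card (S - K) < Suc s"
      using S Z[OF S(2)] finK by auto
  qed
  have "inj_on (\<lambda>Z. K \<union> Z) (nsets (V - K) s)"
    by (intro inj_onI) (use Z(2) in blast)
  then show "card ?A = (card V - card K) choose s"
    using finK assms by (simp add: card_image card_Diff_subset)
qed

text \<open>A set carrying a chain lies inside a member, hence inside the ground set.\<close>

lemma chain_trace_free_iff:
  "chain_trace_free n k r \<A> \<longleftrightarrow> \<A> \<subseteq> nsets {1..n} k \<and> chain_free r \<A>"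
proof -
  have "X \<in> nsets {1..n} r"
    if A: "\<A> \<subseteq> nsets {1..n} k" and X: "card X = r" "trace_contains_maximal_chain \<A> X" for X
  proof -
    obtain S where "S \<in> \<A>" "X \<subseteq> S"
      using trace_contains_maximal_chain_top[OF X(2)] .
    then have "X \<subseteq> {1..n}"
      using A by (auto simp: nsets_def)
    then show ?thesis
      using X(1) finite_subset[of X "{1..n}"] by (auto simp: nsets_def)
  qed
  then show ?thesis
    unfolding chain_trace_free_def chain_free_def nsets_def by blast
qed

theorem theorem2:
  fixes r k :: nat
  assumes "r \<ge> 1" and "k \<ge> r - 1"
  shows "\<exists>n0 :: nat. \<forall>n\<ge>n0. W n k r = (n - k + r - 1) choose (r - 1)"
proof -
  obtain s where r: "r = Suc s" and s: "s \<le> k"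
    using assms by (cases r) auto
  obtain n0 where n0: "\<And>V (\<A> :: nat set set). finite V \<Longrightarrow> n0 \<le> card V \<Longrightarrow> \<A> \<subseteq> nsets V k \<Longrightarrow>
      chain_free (Suc s) \<A> \<Longrightarrow> card \<A> \<le> (card V - k + s) choose s"
    using card_chain_free_le[OF s] by metis
  \<comment> \<open>\<open>n \<ge> k\<close> keeps the truncated subtraction exact and leaves room
    for the core.\<close>
  have "W n k r = (n - k + s) choose s" if n: "n \<ge> max n0 k" for n
    unfolding W_def
  proof (rule Max_eqI[OF finite_chain_trace_free_cards])
    fix y assume "y \<in> {card \<A> | \<A>. chain_trace_free n k r \<A>}"
    then show "y \<le> (n - k + s) choose s"
      using n0[of "{1..n}"] n by (auto simp: chain_trace_free_iff r)
  next
    \<comment> \<open>The core \<open>{1..k - s}\<close> leaves exactly \<open>s\<close> free points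
      in each \<open>k\<close>-set.\<close>
    have "card {1..k - s} + s = k" "card {1..n} - card {1..k - s} = n - k + s" "{1..k - s} \<subseteq> {1..n}"
      using s n by auto
    then obtain \<A> where "chain_trace_free n k r \<A>" "card \<A> = (n - k + s) choose s"
      using exists_chain_free_family[of "{1..n}" "{1..k - s}" s] by (auto simp: chain_trace_free_iff r)
    then show "(n - k + s) choose s \<in> {card \<A> | \<A>. chain_trace_free n k r \<A>}"
      by (metis (mono_tags, lifting) mem_Collect_eq)
  qed
  then show ?thesis
    unfolding r by (intro exI[of _ "max n0 k"]) simp
qed

end
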